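(* For every integer $k\ge1$ and every complex $q$ with $|q|<1$, $$\sum_{\substack{n_k\ge\cdots\ge n_1\ge0\\ l_k\ge\cdots\ge l_1\ge0}}\frac{q^{n_1^2+\cdots+n_k^2+l_1^2+\cdots+l_k^2+n_1+\cdots+n_k+l_1+\cdots+l_k+n_1l_1}}{(q;q)_{n_k-n_{k-1}}\cdots(q;q)_{n_2-n_1}\,(q;q)_{l_k-l_{k-1}}\cdots(q;q)_{l_2-l_1}}\cdot\frac{1}{(q^2;q)_{n_1+l_1}(q;q)_{n_1}(q;q)_{l_1}}$$ $$=\frac{1}{(q^2;q)_\infty}\prod_{\substack{m\ge1\\ m\not\equiv0,\pm1\ (\mathrm{mod}\ 4k+1)}}\frac{1}{1-q^m}.$$
   Context: Notation: $(x;q)_n=\prod_{j=0}^{n-1}(1-xq^j)$ for integers $n\ge0$, and $(x;q)_\infty=\prod_{j\ge0}(1-xq^j)$. The sum is over integers $n_i,l_i$ ($1\le i\le k$); for $k=1$ the products of difference factors are empty (equal to 1). *)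

theory Defs
  imports "HOL-Analysis.Analysis" "HOL-Number_Theory.Cong"
begin

definition qpoch :: "complex \<Rightarrow> complex \<Rightarrow> nat \<Rightarrow> complex" where
  "qpoch x q n = (\<Prod>j<n. 1 - x * q ^ j)"

definition qpoch_inf :: "complex \<Rightarrow> complex \<Rightarrow> complex" where
  "qpoch_inf x q = (\<Prod>j. 1 - x * q ^ j)"

(* Tuples (n_1, ..., n_k) with 0 <= n_1 <= ... <= n_k, encoded as functions on {1..k};
   the extensional function space makes each tuple correspond to exactly one function. *)
definition nondec_tuples :: "nat \<Rightarrow> (nat \<Rightarrow> nat) set" where
  "nondec_tuples k = {n \<in> {1..k} \<rightarrow>\<^sub>E UNIV. mono_on {1..k} n}"

end

(*
  Bailey's lemma at a = q, in two variables.  The factor coupling the two chains,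
    q^(n l) / ((q^2;q)_(n+l) (q;q)_n (q;q)_l) = sum_r alpha_r U(n,r) U(l,r),
  where U(n,r) = 1 / ((q;q)_(n-r) (q^2;q)_(n+r)) and alpha is the unit Bailey sequence, is a limiting
  case of the terminating very-well-poised 6-phi-5 sum.  Since it is diagonal in r, the two chains
  decouple: by the Bailey lemma summing U(n_1,r) over a chain of length k gives
  q^(k(r^2+r)) / (q^2;q)_inf.  What remains, sum_r alpha_r q^(2k(r^2+r)), is a theta series with
  modulus 4k+1, which the Jacobi triple product evaluates.
*)

theory Submission
  imports Defs
begin

subsection \<open>The coupling factor as a diagonal Bailey pair\<close>

text \<open>Decoupling exchanges the sum over r with the infinite sums over both chains, so the
  family indexed by r and two chains has to be absolutely summable. For this alpha_r need only be
  bounded: U(n_1,r) vanishes unless r <= n_1 <= n_1^2, so the quadratic exponent of a chain pays for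
  decay in r, and the linear exponent n_1 + ... + n_k pays for summability over chains.

  The factor 1 - q^(2r+1) in alpha_r is exactly what a bilateral theta series acquires when folded
  onto r >= 0, so the triple product is proved directly in folded form. Its finite version is again
  a sum against U, in base xy instead of q; hence the same contiguous relations for U serve both
  telescoping arguments. The two variables x and y, in place of z and 1/z, keep all exponents
  natural, and q = 0 needs no separate treatment.\<close>

lemma qpoch_0 [simp]: "qpoch x q 0 = 1"
  by (simp add: qpoch_def)

lemma qpoch_Suc: "qpoch x q (Suc n) = qpoch x q n * (1 - x * q ^ n)"
  by (simp add: qpoch_def)

lemma power_neq_one:
  fixes q :: complex
  assumes "norm q < 1" "n > 0"
  shows "q ^ n \<noteq> 1"
proof
  assume "q ^ n = 1"
  then have "norm (q ^ n) = 1" by simp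
  moreover have "norm (q ^ n) < 1"
    using assms by (simp add: norm_power power_less_one_iff)
  ultimately show False by simp
qed

lemma qpoch_q_Suc: "qpoch q q (Suc n) = qpoch q q n * (1 - q ^ Suc n)"
  by (simp add: qpoch_Suc)

lemma qpoch_q2_Suc: "qpoch (q\<^sup>2) q (Suc n) = qpoch (q\<^sup>2) q n * (1 - q ^ (n + 2))"
  by (simp add: qpoch_Suc power_add power2_eq_square mult_ac)

lemma qpoch_q_nonzero: "norm q < 1 \<Longrightarrow> qpoch q q n \<noteq> 0"
  by (induction n) (simp_all add: qpoch_q_Suc power_neq_one del: power_Suc)

lemma qpoch_q2_nonzero: "norm q < 1 \<Longrightarrow> qpoch (q\<^sup>2) q n \<noteq> 0"
  by (induction n) (simp_all add: qpoch_q2_Suc power_neq_one del: power_Suc)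

lemma qpoch_q_eq_q2: "qpoch q q (Suc n) = (1 - q) * qpoch (q\<^sup>2) q n"
proof (induction n)
  case 0
  show ?case by (simp add: qpoch_q_Suc)
next
  case (Suc n)
  have "qpoch q q (Suc (Suc n)) = qpoch q q (Suc n) * (1 - q ^ (n + 2))"
    by (simp add: qpoch_q_Suc)
  with Suc show ?case by (simp add: qpoch_q2_Suc)
qed

text \<open>Subtraction on naturals truncates, so the convention 1/(q;q)_(-m) = 0 for m > 0 is
  imposed by the conditional. It makes the kernel triangular and allows sums over \<open>r\<close>
  to run past \<open>n\<close>.\<close>

definition bailey_kernel :: "complex \<Rightarrow> nat \<Rightarrow> nat \<Rightarrow> complex" where
  "bailey_kernel q n r =
     (if r \<le> n then 1 / (qpoch q q (n - r) * qpoch (q\<^sup>2) q (n + r)) else 0)"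

lemma bailey_kernel_0 [simp]: "bailey_kernel q n 0 = 1 / (qpoch q q n * qpoch (q\<^sup>2) q n)"
  by (simp add: bailey_kernel_def)

lemma bailey_kernel_eq_0: "n < r \<Longrightarrow> bailey_kernel q n r = 0"
  by (simp add: bailey_kernel_def)

text \<open>This relation and the next one, in the other index, reduce all kernel values in a
  telescoping identity to multiples of a single one. Written without division they stay valid at the
  edge of the support, where the factor \<open>1 - q ^ 0\<close> vanishes.\<close>

lemma bailey_kernel_Suc_left:
  assumes "norm q < 1" "r \<le> Suc n"
  shows "bailey_kernel q n r
           = (1 - q ^ (Suc n - r)) * (1 - q ^ (n + r + 2)) * bailey_kernel q (Suc n) r"
proof (cases "r \<le> n")
  case True
  have "Suc n - r = Suc (n - r)" "Suc n + r = Suc (n + r)" using True by auto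
  then show ?thesis
    using True assms
    by (simp add: bailey_kernel_def qpoch_q_Suc qpoch_q2_Suc power_neq_one
          qpoch_q_nonzero qpoch_q2_nonzero del: power_Suc)
next
  case False
  with assms have "r = Suc n" by simp
  then show ?thesis by (simp add: bailey_kernel_def)
qed

lemma bailey_kernel_Suc_right:
  assumes "norm q < 1"
  shows "(1 - q ^ (n + r + 2)) * bailey_kernel q n (Suc r) = (1 - q ^ (n - r)) * bailey_kernel q n r"
proof (cases "Suc r \<le> n")
  case True
  then have "n - r = Suc (n - Suc r)" "n + Suc r = Suc (n + r)" by auto
  then show ?thesis
    using True assms
    by (simp add: bailey_kernel_def qpoch_q_Suc qpoch_q2_Suc power_neq_one
          qpoch_q_nonzero qpoch_q2_nonzero del: power_Suc)
next
  case False
  then show ?thesis by (cases "r = n") (simp_all add: bailey_kernel_def)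
qed

definition bailey_alpha :: "complex \<Rightarrow> nat \<Rightarrow> complex" where
  "bailey_alpha q r = (-1) ^ r * q ^ (r choose 2) * (1 - q ^ (2 * r + 1)) / (1 - q)"

lemma Suc_choose_2: "Suc r choose 2 = (r choose 2) + r"
  by (simp add: numeral_2_eq_2)

text \<open>
  \<open>G\<close> is the Gosper antidifference of the terminating very-well-poised 6-phi-5 summand with one
  free parameter sent to 0.
\<close>

lemma kernel_product_telescope:
  fixes q :: complex and l n :: nat
  assumes q: "norm q < 1" and r: "r \<le> Suc n"
  defines "G \<equiv> \<lambda>r. - ((-1) ^ r * q ^ (r choose 2) / (1 - q) * (1 - q ^ r)
      * ((1 - q ^ (n + r + 2)) * bailey_kernel q (Suc n) r)
      * ((1 - q ^ (l + r + 1)) * bailey_kernel q l r))"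
  shows "(1 - q ^ Suc n) * (1 - q ^ (n + l + 2))
             * (bailey_alpha q r * bailey_kernel q (Suc n) r * bailey_kernel q l r)
           - q ^ l * (bailey_alpha q r * bailey_kernel q n r * bailey_kernel q l r)
         = G (Suc r) - G r"
proof (cases "r \<le> l")
  case False
  then show ?thesis by (simp add: G_def bailey_kernel_eq_0)
next
  case True
  then obtain b where l: "l = r + b" by (metis le_Suc_ex)
  obtain c where n: "Suc n = r + c" using r by (metis le_Suc_ex)
  \<comment> \<open>With l = r + b and n + 1 = r + c no truncated subtraction remains, and both
    sides become polynomials in \<open>q\<close>, \<open>X\<close>, \<open>B\<close>,
    \<open>C\<close>, \<open>e\<close>, \<open>f\<close>, \<open>g\<close>.\<close>
  define X where "X = q ^ r"
  define B where "B = q ^ b"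
  define C where "C = q ^ c"
  define f where "f = bailey_kernel q (Suc n) r"
  define g where "g = bailey_kernel q l r"
  define e where "e = (-1) ^ r * q ^ (r choose 2) / (1 - q)"
  have k1: "bailey_kernel q n r = (1 - C) * (1 - q * X\<^sup>2 * C) * f"
  proof -
    have "n + r + 2 = Suc (r + r + c)" using n by simp
    then have "q ^ (n + r + 2) = q * X\<^sup>2 * C"
      by (simp only:) (simp add: X_def C_def power_add power2_eq_square)
    moreover have "q ^ (Suc n - r) = C" by (simp add: n C_def)
    ultimately show ?thesis
      using bailey_kernel_Suc_left[OF q r] by (simp add: f_def)
  qed
  have p1: "q ^ Suc n = X * C" unfolding n by (simp add: X_def C_def power_add)
  have p2: "q ^ (n + l + 2) = q * X\<^sup>2 * B * C"
  proof -
    have "n + l + 2 = Suc (r + r + b + c)" using n l by simp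
    then show ?thesis by (simp only:) (simp add: X_def B_def C_def power_add power2_eq_square)
  qed
  have p3: "q ^ l = X * B" by (simp add: l X_def B_def power_add)
  have p4: "bailey_alpha q r = e * (1 - q * X\<^sup>2)"
    by (simp add: bailey_alpha_def e_def X_def power_mult mult.commute[of 2])
  have Gr: "G r = - (e * (1 - X) * ((1 - q * X\<^sup>2 * C) * f) * ((1 - q * X\<^sup>2 * B) * g))"
  proof -
    have "n + r + 2 = Suc (r + r + c)" using n by simp
    then have "q ^ (n + r + 2) = q * X\<^sup>2 * C"
      by (simp only:) (simp add: X_def C_def power_add power2_eq_square)
    moreover have "q ^ (l + r + 1) = q * X\<^sup>2 * B"
      by (simp add: l X_def B_def power_add power2_eq_square)
    ultimately show ?thesis unfolding G_def by (simp only: f_def g_def e_def X_def)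
  qed
  have GS: "G (Suc r) = e * X * (1 - q * X) * ((1 - C) * f) * ((1 - B) * g)"
  proof -
    have "(1 - q ^ (n + Suc r + 2)) * bailey_kernel q (Suc n) (Suc r) = (1 - C) * f"
    proof -
      have "n + Suc r + 2 = Suc n + r + 2" "c = Suc n - r" using n by simp_all
      then show ?thesis
        using bailey_kernel_Suc_right[OF q, of "Suc n" r] by (simp only: C_def f_def)
    qed
    moreover have "(1 - q ^ (l + Suc r + 1)) * bailey_kernel q l (Suc r) = (1 - B) * g"
      using bailey_kernel_Suc_right[OF q, of l r] by (simp add: l B_def g_def)
    ultimately have "G (Suc r) = - ((-1) ^ Suc r * q ^ (Suc r choose 2) / (1 - q) * (1 - q ^ Suc r)
       * ((1 - C) * f) * ((1 - B) * g))"
      unfolding G_def by presburger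
    then show ?thesis by (simp add: Suc_choose_2 power_add e_def X_def mult.commute)
  qed
  show ?thesis
    unfolding GS Gr k1 p1 p2 p3 p4 f_def[symmetric] g_def[symmetric]
    by algebra
qed

text \<open>Both sides satisfy the same first-order recurrence in \<open>n\<close>, obtained for the
  left side by telescoping. As l tends to infinity with n > 0 the right side tends to 0, which is
  the defining property sum_r alpha_r U(n,r) = 0 of the unit Bailey pair.\<close>

lemma bailey_pair_product:
  fixes q :: complex
  assumes q: "norm q < 1"
  shows "(\<Sum>r\<le>n. bailey_alpha q r * bailey_kernel q n r * bailey_kernel q l r)
         = q ^ (n * l) / (qpoch (q\<^sup>2) q (n + l) * qpoch q q n * qpoch q q l)"
proof (induction n)
  case 0
  have "1 - q \<noteq> 0" using power_neq_one[OF q, of 1] by simp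
  then show ?case by (simp add: bailey_alpha_def mult.commute binomial_eq_0)
next
  case (Suc n)
  define G where "G = (\<lambda>r. - ((-1) ^ r * q ^ (r choose 2) / (1 - q) * (1 - q ^ r)
      * ((1 - q ^ (n + r + 2)) * bailey_kernel q (Suc n) r)
      * ((1 - q ^ (l + r + 1)) * bailey_kernel q l r)))"
  let ?F = "\<lambda>n r. bailey_alpha q r * bailey_kernel q n r * bailey_kernel q l r"
  have "(\<Sum>r\<le>Suc n. (1 - q ^ Suc n) * (1 - q ^ (n + l + 2)) * ?F (Suc n) r - q ^ l * ?F n r)
      = (\<Sum>r\<le>Suc n. G (Suc r) - G r)"
    by (intro sum.cong refl) (use kernel_product_telescope[OF q, of _ n l] in \<open>simp add: G_def\<close>)
  also have "\<dots> = G (Suc (Suc n)) - G 0"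
    using sum_lessThan_telescope[of G "Suc (Suc n)"] by (simp add: lessThan_Suc_atMost)
  \<comment> \<open>The upper end vanishes with the kernel beyond its support, the lower end with
    the factor \<open>1 - q ^ 0\<close>.\<close>
  also have "\<dots> = 0" by (simp add: G_def bailey_kernel_eq_0)
  finally have "(1 - q ^ Suc n) * (1 - q ^ (n + l + 2)) * (\<Sum>r\<le>Suc n. ?F (Suc n) r)
      = q ^ l * (\<Sum>r\<le>Suc n. ?F n r)"
    unfolding sum_subtractf sum_distrib_left[symmetric] by simp
  also have "(\<Sum>r\<le>Suc n. ?F n r) = (\<Sum>r\<le>n. ?F n r)"
    by (simp add: bailey_kernel_eq_0)
  finally have "(1 - q ^ Suc n) * (1 - q ^ (n + l + 2)) * (\<Sum>r\<le>Suc n. ?F (Suc n) r)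
      = q ^ l * (q ^ (n * l) / (qpoch (q\<^sup>2) q (n + l) * qpoch q q n * qpoch q q l))"
    using Suc by simp
  moreover have "1 - q ^ Suc n \<noteq> 0" "1 - q ^ (n + l + 2) \<noteq> 0"
    using power_neq_one[OF q] by (simp_all del: power_Suc)
  ultimately show ?case
    by (simp add: qpoch_q_Suc qpoch_q2_Suc power_add divide_simps mult_ac
        qpoch_q_nonzero[OF q] qpoch_q2_nonzero[OF q] del: power_Suc)
qed

section \<open>The finite Bailey lemma at a = q\<close>

text \<open>The limit N -> infinity of the q-Chu-Vandermonde sum of q^(m(m+a)) [M,m] [N,m+a], whose
  value is [M+N,M+a]. The offset \<open>a\<close> must stay arbitrary in the induction.\<close>

lemma q_vandermonde:
  fixes q :: complex
  assumes q: "norm q < 1"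
  shows "(\<Sum>m\<le>M. q ^ (m * (m + a)) / (qpoch q q (M - m) * qpoch q q m * qpoch q q (m + a)))
         = 1 / (qpoch q q M * qpoch q q (M + a))"
proof (induction M arbitrary: a)
  case 0
  show ?case by simp
next
  case (Suc M)
  note nz = qpoch_q_nonzero[OF q] 
  have nz1: "1 - q ^ Suc m \<noteq> 0" for m using power_neq_one[OF q, of "Suc m"] by (simp del: power_Suc)
  let ?w = "\<lambda>m. q ^ (m * (m + a)) / qpoch q q (m + a)"
  let ?A = "\<lambda>m. ?w m * q ^ m / (qpoch q q (M - m) * qpoch q q m)"
  let ?B = "\<lambda>m. ?w (Suc m) / (qpoch q q (M - m) * qpoch q q m)"
  have split: "(1 - q ^ Suc M) * (q ^ (m * (m + a)) / (qpoch q q (Suc M - m) * qpoch q q m * qpoch q q (m + a)))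
      = (if m \<le> M then ?A m else 0) + (if m = 0 then 0 else ?B (m - 1))" if "m \<le> Suc M" for m
  proof -
    \<comment> \<open>The Pascal rule, which reduces \<open>(M + 1, a)\<close> to \<open>(M, a + 1)\<close>.\<close>
    have e: "1 - q ^ Suc M = q ^ m * (1 - q ^ (Suc M - m)) + (1 - q ^ m)"
      using that by (simp add: algebra_simps flip: power_add)
    have 1: "(1 - q ^ (Suc M - m)) / qpoch q q (Suc M - m) = (if m \<le> M then 1 / qpoch q q (M - m) else 0)"
    proof (cases "m \<le> M")
      case True
      then have "Suc M - m = Suc (M - m)" by simp
      then show ?thesis using True nz nz1 by (simp add: qpoch_q_Suc del: power_Suc)
    next
      case False
      with that have "m = Suc M" by simp
      then show ?thesis by simp
    qed
    have 2: "(1 - q ^ m) / qpoch q q m = (if m = 0 then 0 else 1 / qpoch q q (m - 1))"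
      by (cases m) (use nz nz1 in \<open>simp_all add: qpoch_q_Suc del: power_Suc\<close>)
    have "(1 - q ^ Suc M) * (q ^ (m * (m + a)) / (qpoch q q (Suc M - m) * qpoch q q m * qpoch q q (m + a)))
        = ?w m * q ^ m * ((1 - q ^ (Suc M - m)) / qpoch q q (Suc M - m)) / qpoch q q m
          + ?w m * ((1 - q ^ m) / qpoch q q m) / qpoch q q (Suc M - m)"
      unfolding e using nz by (simp add: divide_simps) (simp add: algebra_simps)
    also have "\<dots> = (if m \<le> M then ?A m else 0) + (if m = 0 then 0 else ?B (m - 1))"
      unfolding 1 2 by (cases m) (simp_all add: mult_ac del: power_Suc)
    finally show ?thesis .
  qed
  have "(1 - q ^ Suc M) * (\<Sum>m\<le>Suc M. q ^ (m * (m + a)) / (qpoch q q (Suc M - m) * qpoch q q m * qpoch q q (m + a)))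
     = (\<Sum>m\<le>Suc M. (if m \<le> M then ?A m else 0) + (if m = 0 then 0 else ?B (m - 1)))"
    unfolding sum_distrib_left by (intro sum.cong refl split) simp
  also have "\<dots> = (\<Sum>m\<le>M. ?A m) + (\<Sum>m\<le>M. ?B m)"
  proof -
    have "(\<Sum>m\<le>Suc M. if m \<le> M then ?A m else 0) = (\<Sum>m\<le>M. ?A m)" by simp
    moreover have "(\<Sum>m\<le>Suc M. if m = 0 then 0 else ?B (m - 1)) = (\<Sum>m\<le>M. ?B m)"
      by (subst sum.atMost_Suc_shift) simp
    ultimately show ?thesis unfolding sum.distrib by (simp only:)
  qed
  also have "\<dots> = (\<Sum>m\<le>M. q ^ (m * (m + Suc a)) / (qpoch q q (M - m) * qpoch q q m * qpoch q q (m + Suc a)))"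
  proof (subst sum.distrib[symmetric], intro sum.cong refl)
    fix m
    have e: "q ^ (Suc m * (Suc m + a)) = q ^ (m * (m + a)) * q ^ m * q ^ Suc (m + a)"
      by (simp flip: power_add power_Suc) (simp add: algebra_simps)
    \<comment> \<open>Over the common denominator (q;q)_(m+a+1) the numerators
      \<open>1 - q ^ Suc (m + a)\<close> and \<open>q ^ Suc (m + a)\<close> add up to 1; this is
      what raises \<open>a\<close> by one.\<close>
    have "?w m * q ^ m + ?w (Suc m) = q ^ (m * (m + a)) * q ^ m / qpoch q q (Suc (m + a))"
      unfolding e using nz nz1
      by (simp add: qpoch_q_Suc divide_simps del: power_Suc) (simp add: algebra_simps)
    moreover have "?A m + ?B m = (?w m * q ^ m + ?w (Suc m)) / (qpoch q q (M - m) * qpoch q q m)"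
      by (simp only: add_divide_distrib)
    ultimately show "?A m + ?B m
      = q ^ (m * (m + Suc a)) / (qpoch q q (M - m) * qpoch q q m * qpoch q q (m + Suc a))"
      by (simp add: power_add mult_ac)
  qed
  also have "\<dots> = 1 / (qpoch q q M * qpoch q q (M + Suc a))" by (rule Suc)
  finally show ?case using nz nz1[of M]
    by (simp add: qpoch_q_Suc[of q M] divide_simps mult_ac del: power_Suc)
qed

lemma bailey_kernel_alt:
  assumes "norm q < 1"
  shows "bailey_kernel q (r + m) r = (1 - q) / (qpoch q q m * qpoch q q (m + (2 * r + 1)))"
proof -
  have "1 - q \<noteq> 0" using power_neq_one[OF assms, of 1] by simp
  then show ?thesis
    using qpoch_q_eq_q2[of q "r + m + r"]
    by (simp add: bailey_kernel_def mult_2 add_ac)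
qed

text \<open>The Bailey lemma with both of its free parameters sent to infinity, read column by
  column: each column of the kernel is an eigenvector of one chain step. The shift n = r + m reduces
  it to \<open>q_vandermonde\<close> with a = 2r + 1, the odd offset coming from (q^2;q) rewritten
  through (q;q).\<close>

lemma bailey_lemma_kernel:
  fixes q :: complex
  assumes q: "norm q < 1"
  shows "(\<Sum>n\<le>N. q ^ (n\<^sup>2 + n) / qpoch q q (N - n) * bailey_kernel q n r)
           = q ^ (r\<^sup>2 + r) * bailey_kernel q N r"
proof (cases "r \<le> N")
  case False
  then show ?thesis by (simp add: bailey_kernel_eq_0)
next
  case True
  then obtain M where N: "N = r + M" by (metis le_Suc_ex)
  let ?f = "\<lambda>n. q ^ (n\<^sup>2 + n) / qpoch q q (N - n) * bailey_kernel q n r"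
  have "(\<Sum>n\<le>N. ?f n) = (\<Sum>n\<in>{r..N}. ?f n)"
    by (intro sum.mono_neutral_right) (auto simp: bailey_kernel_eq_0)
  also have "\<dots> = (\<Sum>m\<le>M. ?f (r + m))"
    by (intro sum.reindex_bij_witness[of _ "\<lambda>m. r + m" "\<lambda>n. n - r"]) (auto simp: N)
  also have "\<dots> = (\<Sum>m\<le>M. q ^ (r\<^sup>2 + r) * (1 - q) * (q ^ (m * (m + (2 * r + 1)))
        / (qpoch q q (M - m) * qpoch q q m * qpoch q q (m + (2 * r + 1)))))"
  proof (intro sum.cong refl)
    fix m
    have "(r + m)\<^sup>2 + (r + m) = r\<^sup>2 + r + m * (m + (2 * r + 1))"
      by (simp add: power2_eq_square algebra_simps)
    then show "?f (r + m) = q ^ (r\<^sup>2 + r) * (1 - q) * (q ^ (m * (m + (2 * r + 1)))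
        / (qpoch q q (M - m) * qpoch q q m * qpoch q q (m + (2 * r + 1))))"
      unfolding bailey_kernel_alt[OF q] by (simp only: N power_add) (simp add: mult_ac)
  qed
  also have "\<dots> = q ^ (r\<^sup>2 + r) * bailey_kernel q N r"
    unfolding sum_distrib_left[symmetric] q_vandermonde[OF q] N bailey_kernel_alt[OF q] by simp
  finally show ?thesis .
qed

subsection \<open>Infinite products and the triple product identity\<close>

lemma convergent_prod_qpoch:
  fixes x q :: complex
  assumes "norm q < 1"
  shows "convergent_prod (\<lambda>j. 1 - x * q ^ j)"
proof (intro abs_convergent_prod_imp_convergent_prod summable_imp_abs_convergent_prod)
  have "summable (\<lambda>j. norm x * norm q ^ j)"
    using assms by (intro summable_mult summable_geometric) simp
  then show "summable (\<lambda>j. norm (1 - x * q ^ j - 1))"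
    by (simp add: norm_mult norm_power)
qed

lemma qpoch_tendsto:
  assumes "norm q < 1"
  shows "qpoch x q \<longlonglongrightarrow> qpoch_inf x q"
proof -
  have "(\<lambda>n. \<Prod>j<n. 1 - x * q ^ j) \<longlonglongrightarrow> qpoch_inf x q"
    using convergent_prod_LIMSEQ[OF convergent_prod_qpoch[OF assms, of x]]
    unfolding qpoch_inf_def LIMSEQ_lessThan_iff_atMost .
  then show ?thesis by (simp add: qpoch_def[abs_def])
qed

lemma qpoch_inf_q_nonzero:
  assumes "norm q < 1"
  shows "qpoch_inf q q \<noteq> 0"
  unfolding qpoch_inf_def
proof (rule prodinf_nonzero[OF convergent_prod_qpoch[OF assms]])
  show "1 - q * q ^ j \<noteq> 0" for j
    using power_neq_one[OF assms, of "Suc j"] by simp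
qed

lemma qpoch_inf_q_eq_q2:
  assumes "norm q < 1"
  shows "qpoch_inf q q = (1 - q) * qpoch_inf (q\<^sup>2) q"
proof (rule LIMSEQ_unique)
  show "(\<lambda>n. qpoch q q (Suc n)) \<longlonglongrightarrow> qpoch_inf q q"
    by (rule LIMSEQ_Suc[OF qpoch_tendsto[OF assms]])
  show "(\<lambda>n. qpoch q q (Suc n)) \<longlonglongrightarrow> (1 - q) * qpoch_inf (q\<^sup>2) q"
    unfolding qpoch_q_eq_q2 by (intro tendsto_intros qpoch_tendsto assms)
qed

lemma qpoch_inf_q2_nonzero:
  assumes "norm q < 1"
  shows "qpoch_inf (q\<^sup>2) q \<noteq> 0"
  using qpoch_inf_q_nonzero[OF assms] qpoch_inf_q_eq_q2[OF assms] by auto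

text \<open>Convergent sequences with nonzero limits have bounded reciprocals. A single constant for
  all of them supplies the dominating series for Tannery's theorem and for the sums over
  chains.\<close>

lemma qpoch_bounds:
  assumes q: "norm q < 1"
  obtains C where "C > 0" "\<And>n. norm (qpoch q q n) \<le> C" "\<And>n. norm (1 / qpoch q q n) \<le> C"
    "\<And>n r. norm (bailey_kernel q n r) \<le> C"
proof -
  have "Bseq (qpoch q q)"
    by (intro convergent_imp_Bseq convergentI[OF qpoch_tendsto[OF q]])
  then obtain A where A: "A > 0" "\<And>n. norm (qpoch q q n) \<le> A" by (auto simp: Bseq_def)
  have "(\<lambda>n. 1 / qpoch q q n) \<longlonglongrightarrow> 1 / qpoch_inf q q"
    by (intro tendsto_intros qpoch_tendsto q qpoch_inf_q_nonzero)
  then have "Bseq (\<lambda>n. 1 / qpoch q q n)"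
    by (intro convergent_imp_Bseq convergentI)
  then obtain B where B: "B > 0" "\<And>n. norm (1 / qpoch q q n) \<le> B" by (auto simp: Bseq_def)
  have "(\<lambda>n. 1 / qpoch (q\<^sup>2) q n) \<longlonglongrightarrow> 1 / qpoch_inf (q\<^sup>2) q"
    by (intro tendsto_intros qpoch_tendsto q qpoch_inf_q2_nonzero)
  then have "Bseq (\<lambda>n. 1 / qpoch (q\<^sup>2) q n)"
    by (intro convergent_imp_Bseq convergentI)
  then obtain D where D: "D > 0" "\<And>n. norm (1 / qpoch (q\<^sup>2) q n) \<le> D" by (auto simp: Bseq_def)
  have kernel: "norm (bailey_kernel q n r) \<le> B * D" for n r
  proof (cases "r \<le> n")
    case True
    then have "bailey_kernel q n r = (1 / qpoch q q (n - r)) * (1 / qpoch (q\<^sup>2) q (n + r))"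
      by (simp add: bailey_kernel_def)
    then have "norm (bailey_kernel q n r)
      = norm (1 / qpoch q q (n - r)) * norm (1 / qpoch (q\<^sup>2) q (n + r))"
      by (simp only: norm_mult)
    also have "\<dots> \<le> B * D"
      using B D by (intro mult_mono) (auto intro: less_imp_le)
    finally show ?thesis .
  next
    case False
    then show ?thesis using B(1) D(1) by (simp add: bailey_kernel_def)
  qed
  show ?thesis
  proof (rule that[of "A + B + B * D"])
    show "A + B + B * D > 0" using A B D by (simp add: add_pos_pos)
    have "B * D > 0" using B D by simp
    then show "norm (qpoch q q n) \<le> A + B + B * D" "norm (1 / qpoch q q n) \<le> A + B + B * D"
      "norm (bailey_kernel q n r) \<le> A + B + B * D" for n r
      using A(1) A(2)[of n] B(1) B(2)[of n] kernel[of n r] by linarith+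
  qed
qed

lemma bailey_kernel_tendsto:
  assumes q: "norm q < 1"
  shows "(\<lambda>n. bailey_kernel q n r) \<longlonglongrightarrow> 1 / (qpoch_inf q q * qpoch_inf (q\<^sup>2) q)"
proof (rule LIMSEQ_offset[of _ r])
  have "bailey_kernel q (n + r) r = 1 / (qpoch q q n * qpoch (q\<^sup>2) q (n + 2 * r))" for n
    by (simp add: bailey_kernel_def mult_2 add_ac)
  moreover have "(\<lambda>n. 1 / (qpoch q q n * qpoch (q\<^sup>2) q (n + 2 * r)))
      \<longlonglongrightarrow> 1 / (qpoch_inf q q * qpoch_inf (q\<^sup>2) q)"
    by (intro tendsto_intros LIMSEQ_ignore_initial_segment qpoch_tendsto q)
       (simp add: qpoch_inf_q_nonzero qpoch_inf_q2_nonzero q)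
  ultimately show "(\<lambda>n. bailey_kernel q (n + r) r)
      \<longlonglongrightarrow> 1 / (qpoch_inf q q * qpoch_inf (q\<^sup>2) q)" by simp
qed

lemma norm_power_le_power:
  fixes q :: complex
  assumes "norm q < 1" "n \<le> m"
  shows "norm (q ^ m) \<le> norm q ^ n"
  unfolding norm_power by (rule power_decreasing) (use assms in auto)

lemma suminf_atMost_if: "(\<Sum>n. if n \<le> N then f n else 0) = (\<Sum>n\<le>N. f n :: complex)"
  by (subst suminf_finite[of "{..N}"]) auto

lemma bailey_lemma_kernel_sums:
  fixes q :: complex
  assumes q: "norm q < 1"
  shows "(\<lambda>n. q ^ (n\<^sup>2 + n) * bailey_kernel q n r) sums (q ^ (r\<^sup>2 + r) / qpoch_inf (q\<^sup>2) q)"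
proof -
  obtain C where C: "C > 0" "\<And>n. norm (qpoch q q n) \<le> C" "\<And>n. norm (1 / qpoch q q n) \<le> C"
    "\<And>n r. norm (bailey_kernel q n r) \<le> C"
    using qpoch_bounds[OF q] by metis
  define t where "t = (\<lambda>n. q ^ (n\<^sup>2 + n) * bailey_kernel q n r)"
  \<comment> \<open>The extra factor \<open>qpoch q q N\<close> makes the quotient by
    \<open>qpoch q q (N - n)\<close> tend to 1, so the summand tends to \<open>t n\<close> itself.
    On the other side it cancels the (q;q)_inf in the limit of the kernel.\<close>
  define a where "a = (\<lambda>n N. if n \<le> N then t n * (qpoch q q N * (1 / qpoch q q (N - n))) else 0)"
  have lim: "(\<lambda>N. a n N) \<longlonglongrightarrow> t n" for n
  proof (rule LIMSEQ_offset[of _ n])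
    have "(\<lambda>N. t n * (qpoch q q (N + n) * (1 / qpoch q q N)))
       \<longlonglongrightarrow> t n * (qpoch_inf q q * (1 / qpoch_inf q q))"
      by (intro tendsto_intros LIMSEQ_ignore_initial_segment qpoch_tendsto q qpoch_inf_q_nonzero)
    then show "(\<lambda>N. a n (N + n)) \<longlonglongrightarrow> t n"
      using qpoch_inf_q_nonzero[OF q] by (simp add: a_def)
  qed
  have "norm (a n N) \<le> norm q ^ n * C * (C * C)" for n N
  proof (cases "n \<le> N")
    case True
    then have "norm (a n N) = norm (q ^ (n\<^sup>2 + n)) * norm (bailey_kernel q n r)
        * (norm (qpoch q q N) * norm (1 / qpoch q q (N - n)))"
      by (simp only: a_def t_def norm_mult if_True)
    also have "\<dots> \<le> norm q ^ n * C * (C * C)"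
      by (intro mult_mono norm_power_le_power C q mult_nonneg_nonneg less_imp_le[OF C(1)]) auto
    finally show ?thesis .
  next
    case False
    then show ?thesis using C(1) by (simp add: a_def)
  qed
  then have tannery: "summable (\<lambda>n. norm (t n)) \<and> (\<lambda>N. \<Sum>n. a n N) \<longlonglongrightarrow> suminf t"
    using q by (intro conjunct2[OF tannerys_theorem[OF lim, where M = "\<lambda>n. norm q ^ n * C * (C * C)"]])
      (auto intro!: always_eventually summable_mult2 summable_geometric)
  have sum_a: "(\<Sum>n. a n N) = q ^ (r\<^sup>2 + r) * bailey_kernel q N r * qpoch q q N" for N
    unfolding a_def suminf_atMost_if t_def bailey_lemma_kernel[OF q, symmetric] sum_distrib_right
    by (simp add: mult_ac)
  have "(\<lambda>N. q ^ (r\<^sup>2 + r) * bailey_kernel q N r * qpoch q q N)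
      \<longlonglongrightarrow> q ^ (r\<^sup>2 + r) * (1 / (qpoch_inf q q * qpoch_inf (q\<^sup>2) q)) * qpoch_inf q q"
    by (intro tendsto_intros bailey_kernel_tendsto qpoch_tendsto q)
  from LIMSEQ_unique[OF conjunct2[OF tannery, unfolded sum_a] this]
  have "suminf t = q ^ (r\<^sup>2 + r) / qpoch_inf (q\<^sup>2) q"
    using qpoch_inf_q_nonzero[OF q] by simp
  moreover have "summable t" using tannery by (intro summable_norm_cancel[of t]) simp
  ultimately have "t sums (q ^ (r\<^sup>2 + r) / qpoch_inf (q\<^sup>2) q)" by (simp add: sums_iff)
  then show ?thesis by (simp only: t_def)
qed

text \<open>
  The summand is that of the bilateral finite Jacobi triple product
  \<open>\<Sum>j. (-1)^j x^(j(j-1)/2) y^(j(j+1)/2) [2n+1, n-j]\<close> folded along \<open>j \<leftrightarrow> -1-j\<close>, whence the factor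
  \<open>1 - x^(2r+1)\<close>.  Accordingly \<open>H\<close> is the difference of the antidifferences of the two halves,
  whose boundary values at \<open>r = 0\<close> cancel.
\<close>

lemma theta_telescope:
  fixes x y :: complex and n r :: nat
  defines "Q \<equiv> x * y"
  assumes Q: "norm Q < 1" and r: "r \<le> Suc n"
  defines "E \<equiv> \<lambda>r. (-1) ^ r * x ^ (r choose 2) * y ^ (Suc r choose 2)"
  defines "H \<equiv> \<lambda>r. - ((1 - Q ^ (n + r + 2)) * bailey_kernel Q (Suc n) r)
     * E r * (x * Q ^ Suc n * (1 - Q ^ (Suc n - r)) + Q ^ (Suc n - r) * (1 - Q ^ (n + r + 1))
        - x ^ (2 * r + 1) * (y * Q ^ n * (1 - Q ^ (Suc n - r)) + Q ^ (Suc n - r) * (1 - Q ^ (n + r + 1))))"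
  shows "(1 - Q ^ (2 * n + 2)) * (1 - Q ^ (2 * n + 3)) * (E r * (1 - x ^ (2 * r + 1)) * bailey_kernel Q (Suc n) r)
           - (1 - x * Q ^ Suc n) * (1 - y * Q ^ n) * (E r * (1 - x ^ (2 * r + 1)) * bailey_kernel Q n r)
         = H (Suc r) - H r"
proof -
  obtain c where n: "Suc n = r + c" using r by (metis le_Suc_ex)
  define X where "X = Q ^ r"
  define C where "C = Q ^ c"
  define f where "f = bailey_kernel Q (Suc n) r"
  define z where "z = x ^ (2 * r + 1)"
  have i1: "n + r + 2 = Suc (r + r + c)" and i2: "n + r + 1 = r + r + c"
    and i3: "2 * n + 2 = r + r + c + c" and i4: "2 * n + 3 = Suc (r + r + c + c)"
    and i5: "Suc n - r = c" and i6: "n + Suc r + 2 = Suc n + r + 2" and i7: "n + Suc r + 1 = Suc (r + r + c)"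
    using n by simp_all
  have p: "Q ^ (n + r + 2) = Q * X\<^sup>2 * C" "Q ^ (n + r + 1) = X\<^sup>2 * C"
    "Q ^ (2 * n + 2) = X\<^sup>2 * C\<^sup>2" "Q ^ (2 * n + 3) = Q * X\<^sup>2 * C\<^sup>2" "Q ^ Suc n = X * C"
    "Q ^ (n + Suc r + 1) = Q * X\<^sup>2 * C"
    unfolding i1 i2 i3 i4 i7 unfolding n
    by (simp_all add: X_def C_def power_add power2_eq_square mult_ac)
  have k1: "bailey_kernel Q n r = (1 - C) * (1 - Q * X\<^sup>2 * C) * f"
    using bailey_kernel_Suc_left[OF Q r] unfolding i5 p C_def[symmetric] f_def .
  have W: "(1 - Q ^ (n + Suc r + 2)) * bailey_kernel Q (Suc n) (Suc r) = (1 - C) * f"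
    using bailey_kernel_Suc_right[OF Q, of "Suc n" r] unfolding i5 i6 C_def f_def .
  have E_Suc: "E (Suc r) = - (y * X * E r)"
    by (simp add: E_def X_def Q_def Suc_choose_2 power_add power_mult_distrib mult_ac)
  have z_Suc: "x ^ (2 * Suc r + 1) = x\<^sup>2 * z"
    by (simp add: z_def power2_eq_square)
  have Hr: "H r = - ((1 - Q * X\<^sup>2 * C) * f) * E r * (x * (X * C) * (1 - C) + C * (1 - X\<^sup>2 * C)
      - z * (y * Q ^ n * (1 - C) + C * (1 - X\<^sup>2 * C)))"
    unfolding H_def p i5 C_def[symmetric] f_def[symmetric] z_def[symmetric] ..
  show ?thesis
  proof (cases c)
    \<comment> \<open>\<open>H (Suc r)\<close> contains the exponent c - 1, which truncates at c =
      0; there the factor \<open>1 - C\<close> vanishes, so the spurious power is harmless.\<close>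
    case 0
    then have "C = 1" by (simp add: C_def)
    then have HS: "H (Suc r) = 0" unfolding H_def W by simp
    show ?thesis unfolding HS Hr p k1 f_def[symmetric] z_def[symmetric] \<open>C = 1\<close>
      by (simp add: algebra_simps power2_eq_square)
  next
    case (Suc d)
    define D where "D = Q ^ d"
    have C: "C = x * y * D" by (simp add: C_def D_def Suc Q_def)
    have "n = r + d" "Suc n - Suc r = d" using n Suc by simp_all
    then have Qn: "Q ^ n = X * D" and Qd: "Q ^ (Suc n - Suc r) = D"
      by (simp_all add: X_def D_def power_add)
    have HS: "H (Suc r) = - ((1 - C) * f) * (- (y * X * E r)) * (x * (X * C) * (1 - D) + D * (1 - Q * X\<^sup>2 * C)
      - x\<^sup>2 * z * (y * (X * D) * (1 - D) + D * (1 - Q * X\<^sup>2 * C)))"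
      unfolding H_def W E_Suc z_Suc p Qn Qd ..
    show ?thesis unfolding HS Hr p k1 f_def[symmetric] z_def[symmetric] Qn
      unfolding C Q_def
      by algebra
  qed
qed

text \<open>Multiplied by the denominator on the right, the kernel becomes the Gaussian binomial
  [2n+1, n-r] in base xy. The identity is then the q-binomial theorem for the 2n+1 factors in the
  numerator.\<close>

lemma theta_finite:
  fixes x y :: complex
  assumes Q: "norm (x * y) < 1"
  shows "(\<Sum>r\<le>n. (-1) ^ r * x ^ (r choose 2) * y ^ (Suc r choose 2) * (1 - x ^ (2 * r + 1))
            * bailey_kernel (x * y) n r)
         = qpoch x (x * y) (Suc n) * qpoch y (x * y) n / qpoch ((x * y)\<^sup>2) (x * y) (2 * n)"
proof (induction n)
  case 0
  show ?case by (simp add: qpoch_def binomial_eq_0)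
next
  case (Suc n)
  define q where "q = x * y"
  define E where "E = (\<lambda>r. (-1) ^ r * x ^ (r choose 2) * y ^ (Suc r choose 2))"
  define H where "H = (\<lambda>r. - ((1 - q ^ (n + r + 2)) * bailey_kernel q (Suc n) r)
     * E r * (x * q ^ Suc n * (1 - q ^ (Suc n - r)) + q ^ (Suc n - r) * (1 - q ^ (n + r + 1))
        - x ^ (2 * r + 1) * (y * q ^ n * (1 - q ^ (Suc n - r)) + q ^ (Suc n - r) * (1 - q ^ (n + r + 1)))))"
  let ?F = "\<lambda>n r. E r * (1 - x ^ (2 * r + 1)) * bailey_kernel q n r"
  have "(\<Sum>r\<le>Suc n. (1 - q ^ (2 * n + 2)) * (1 - q ^ (2 * n + 3)) * ?F (Suc n) r
        - (1 - x * q ^ Suc n) * (1 - y * q ^ n) * ?F n r)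
      = (\<Sum>r\<le>Suc n. H (Suc r) - H r)"
    unfolding q_def E_def H_def
    by (intro sum.cong refl theta_telescope[OF Q]) simp
  also have "\<dots> = H (Suc (Suc n)) - H 0"
    using sum_lessThan_telescope[of H "Suc (Suc n)"] by (simp add: lessThan_Suc_atMost)
  also have "H (Suc (Suc n)) = 0" by (simp add: H_def bailey_kernel_eq_0)
  also have "H 0 = 0" by (simp add: H_def E_def q_def binomial_eq_0 algebra_simps)
  finally have "(1 - q ^ (2 * n + 2)) * (1 - q ^ (2 * n + 3)) * (\<Sum>r\<le>Suc n. ?F (Suc n) r)
      = (1 - x * q ^ Suc n) * (1 - y * q ^ n) * (\<Sum>r\<le>Suc n. ?F n r)"
    unfolding sum_subtractf sum_distrib_left[symmetric] by simp
  also have "(\<Sum>r\<le>Suc n. ?F n r) = (\<Sum>r\<le>n. ?F n r)"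
    by (simp add: bailey_kernel_eq_0)
  also have "\<dots> = qpoch x q (Suc n) * qpoch y q n / qpoch (q\<^sup>2) q (2 * n)"
    using Suc by (simp only: q_def E_def)
  finally have *: "(1 - q ^ (2 * n + 2)) * (1 - q ^ (2 * n + 3)) * (\<Sum>r\<le>Suc n. ?F (Suc n) r)
      = qpoch x q (Suc (Suc n)) * qpoch y q (Suc n) / qpoch (q\<^sup>2) q (2 * n)"
    by (simp add: qpoch_Suc[of x q "Suc n"] qpoch_Suc[of y q n])
  have "2 * Suc n = Suc (Suc (2 * n))" "Suc (2 * n) + 2 = 2 * n + 3" by simp_all
  then have "qpoch (q\<^sup>2) q (2 * Suc n) = qpoch (q\<^sup>2) q (2 * n) * ((1 - q ^ (2 * n + 2)) * (1 - q ^ (2 * n + 3)))"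
    by (simp only: qpoch_q2_Suc mult.assoc)
  moreover have "1 - q ^ (2 * n + 2) \<noteq> 0" "1 - q ^ (2 * n + 3) \<noteq> 0"
    using power_neq_one[OF Q, of "2 * n + 2"] power_neq_one[OF Q, of "2 * n + 3"]
    unfolding q_def by simp_all
  then have "(1 - q ^ (2 * n + 2)) * (1 - q ^ (2 * n + 3)) \<noteq> 0" by (simp only: mult_eq_0_iff) blast
  then have "(\<Sum>r\<le>Suc n. ?F (Suc n) r) = (1 - q ^ (2 * n + 2)) * (1 - q ^ (2 * n + 3)) * (\<Sum>r\<le>Suc n. ?F (Suc n) r)
      / ((1 - q ^ (2 * n + 2)) * (1 - q ^ (2 * n + 3)))"
    by (rule nonzero_mult_div_cancel_left[symmetric])
  ultimately have "(\<Sum>r\<le>Suc n. ?F (Suc n) r)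
      = qpoch x q (Suc (Suc n)) * qpoch y q (Suc n) / qpoch (q\<^sup>2) q (2 * Suc n)"
    unfolding * by (simp only: divide_divide_eq_left)
  then show ?case by (simp only: q_def E_def)
qed

text \<open>The Jacobi triple product in base xy, as the limit of \<open>theta_finite\<close>: the
  kernel tends to a constant \<open>K\<close> not depending on \<open>r\<close>, which is divided
  out at the end.\<close>

lemma theta_sums:
  fixes x y :: complex
  assumes x: "norm x < 1" and y: "norm y < 1"
  shows "(\<lambda>r. (-1) ^ r * x ^ (r choose 2) * y ^ (Suc r choose 2) * (1 - x ^ (2 * r + 1)))
           sums (qpoch_inf x (x * y) * qpoch_inf y (x * y) * qpoch_inf (x * y) (x * y))"
proof -
  define q where "q = x * y"
  have q: "norm q < 1"
    using mult_strict_mono'[of "norm x" 1 "norm y" 1] x y by (simp add: q_def norm_mult)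
  obtain C where C: "C > 0" "\<And>n r. norm (bailey_kernel q n r) \<le> C"
    using qpoch_bounds[OF q] by metis
  define s where "s = (\<lambda>r. (-1) ^ r * x ^ (r choose 2) * y ^ (Suc r choose 2) * (1 - x ^ (2 * r + 1)))"
  define K where "K = 1 / (qpoch_inf q q * qpoch_inf (q\<^sup>2) q)"
  have lim: "(\<lambda>n. s r * bailey_kernel q n r) \<longlonglongrightarrow> s r * K" for r
    unfolding K_def by (intro tendsto_intros bailey_kernel_tendsto q)
  \<comment> \<open>Since \<open>Suc r choose 2\<close> is at least \<open>r\<close>, the powers of
    \<open>y\<close> alone give a geometric majorant; the powers of \<open>x\<close> are only
    bounded by 1.\<close>
  have "norm (s r) \<le> norm y ^ r * 2" for r
  proof -
    have "norm (1 - x ^ (2 * r + 1)) \<le> norm (1::complex) + norm (x ^ (2 * r + 1))"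
      by (rule norm_triangle_ineq4)
    also have "\<dots> \<le> 2" using norm_power_le_power[OF x, of 0 "2 * r + 1"] by simp
    finally have 1: "norm (1 - x ^ (2 * r + 1)) \<le> 2" .
    have "norm (s r) = norm (x ^ (r choose 2)) * norm (y ^ (Suc r choose 2)) * norm (1 - x ^ (2 * r + 1))"
      by (simp only: s_def norm_mult) (simp add: norm_power)
    also have "\<dots> \<le> 1 * norm y ^ r * 2"
      using norm_power_le_power[OF x, of 0 "r choose 2"] 1
      by (intro mult_mono norm_power_le_power[OF y]) (auto simp: Suc_choose_2)
    finally show ?thesis by simp
  qed
  then have bound: "norm (s r * bailey_kernel q n r) \<le> norm y ^ r * 2 * C" for r n
    unfolding norm_mult by (intro mult_mono C) auto
  have "summable (\<lambda>r. norm (s r * K)) \<and> (\<lambda>n. \<Sum>r. s r * bailey_kernel q n r) \<longlonglongrightarrow> (\<Sum>r. s r * K)"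
    using y bound by (intro conjunct2[OF tannerys_theorem[OF lim, where M = "\<lambda>r. norm y ^ r * 2 * C"]])
      (auto intro!: always_eventually summable_mult2 summable_geometric)
  then have sm: "summable (\<lambda>r. s r * K)" and
    lm: "(\<lambda>n. \<Sum>r. s r * bailey_kernel q n r) \<longlonglongrightarrow> (\<Sum>r. s r * K)"
    by (auto intro: summable_norm_cancel)
  have "(\<Sum>r. s r * bailey_kernel q n r) = (\<Sum>r\<le>n. s r * bailey_kernel q n r)" for n
    by (rule suminf_finite) (auto simp: bailey_kernel_eq_0)
  also have "(\<Sum>r\<le>n. s r * bailey_kernel q n r)
      = qpoch x q (Suc n) * qpoch y q n / qpoch (q\<^sup>2) q (2 * n)" for n
    using theta_finite[of x y n] q by (simp only: s_def q_def)
  finally have "(\<lambda>n. qpoch x q (Suc n) * qpoch y q n / qpoch (q\<^sup>2) q (2 * n)) \<longlonglongrightarrow> (\<Sum>r. s r * K)"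
    using lm by simp
  moreover have "(\<lambda>n. qpoch x q (Suc n) * qpoch y q n / qpoch (q\<^sup>2) q (2 * n))
      \<longlonglongrightarrow> qpoch_inf x q * qpoch_inf y q / qpoch_inf (q\<^sup>2) q"
  proof (intro tendsto_intros qpoch_tendsto q LIMSEQ_Suc qpoch_inf_q2_nonzero)
    show "(\<lambda>n. qpoch (q\<^sup>2) q (2 * n)) \<longlonglongrightarrow> qpoch_inf (q\<^sup>2) q"
      by (rule filterlim_compose[OF qpoch_tendsto[OF q]], rule filterlim_subseq)
         (simp add: strict_mono_def)
  qed
  ultimately have "(\<Sum>r. s r * K) = qpoch_inf x q * qpoch_inf y q / qpoch_inf (q\<^sup>2) q"
    by (rule LIMSEQ_unique)
  with sm have "(\<lambda>r. s r * K) sums (qpoch_inf x q * qpoch_inf y q / qpoch_inf (q\<^sup>2) q)"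
    by (metis summable_sums)
  then have "(\<lambda>r. s r * K / K) sums (qpoch_inf x q * qpoch_inf y q / qpoch_inf (q\<^sup>2) q / K)"
    by (rule sums_divide)
  moreover have "K \<noteq> 0" using qpoch_inf_q_nonzero[OF q] qpoch_inf_q2_nonzero[OF q] by (simp add: K_def)
  moreover have "qpoch_inf x q * qpoch_inf y q / qpoch_inf (q\<^sup>2) q / K = qpoch_inf x q * qpoch_inf y q * qpoch_inf q q"
    using qpoch_inf_q_nonzero[OF q] qpoch_inf_q2_nonzero[OF q] by (simp add: K_def)
  ultimately have "s sums (qpoch_inf x q * qpoch_inf y q * qpoch_inf q q)" by simp
  then show ?thesis by (simp only: s_def q_def)
qed

subsection \<open>Products over residue classes\<close>

lemma norm_power_less_one:
  fixes q :: complex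
  assumes "norm q < 1" "m > 0"
  shows "norm (q ^ m) < 1"
  using assms by (simp add: norm_power power_less_one_iff)

text \<open>The cut falls just after m = M n + 1, so each step of \<open>n\<close> adds one factor
  to each of the three classes, which are distinct because M >= 3. The class of 1 is one factor
  ahead because it already contains m = 1.\<close>

lemma residue_prod:
  fixes q :: complex
  assumes M: "M \<ge> 3"
  shows "(\<Prod>m<M * n + 2. if m \<ge> 1 \<and> m mod M \<in> {0, 1, M - 1} then 1 - q ^ m else 1)
           = qpoch q (q ^ M) (Suc n) * qpoch (q ^ (M - 1)) (q ^ M) n * qpoch (q ^ M) (q ^ M) n"
proof (induction n)
  case 0
  have "{..<2::nat} = {0, 1}" by auto
  then show ?case using M by (simp add: qpoch_def)
next
  case (Suc n)
  let ?g = "\<lambda>m. if m \<ge> 1 \<and> m mod M \<in> {0, 1, M - 1} then 1 - q ^ m else 1"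
  have e: "M * Suc n - 1 = (M - 1) + M * n" using M by simp
  have "(\<Prod>m<M * Suc n + 2. ?g m) = (\<Prod>m<M * n + 2. ?g m) * (\<Prod>m\<in>{M * n + 2..<M * Suc n + 2}. ?g m)"
    unfolding lessThan_atLeast0 by (rule prod.atLeastLessThan_concat[symmetric]) simp_all
  also have "(\<Prod>m\<in>{M * n + 2..<M * Suc n + 2}. ?g m)
      = (\<Prod>m\<in>{M * Suc n - 1, M * Suc n, M * Suc n + 1}. 1 - q ^ m)"
  proof (rule prod.mono_neutral_cong_right)
    show "\<forall>m\<in>{M * n + 2..<M * Suc n + 2} - {M * Suc n - 1, M * Suc n, M * Suc n + 1}. ?g m = 1"
    proof
      fix m assume m: "m \<in> {M * n + 2..<M * Suc n + 2} - {M * Suc n - 1, M * Suc n, M * Suc n + 1}"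
      define j where "j = m - M * n"
      have "m = M * n + j" "2 \<le> j" "j < M - 1" using m M by (auto simp: j_def)
      then have "m mod M = j" "j \<notin> {0, 1, M - 1}" by auto
      then show "?g m = 1" by simp
    qed
    have "(M * Suc n - 1) mod M = M - 1"
      unfolding e by (subst mod_mult_self2) (use M in simp)
    moreover have "(M * Suc n + 1) mod M = 1"
    proof -
      have "(M * Suc n + 1) mod M = 1 mod M" by (rule mod_mult_self4)
      then show ?thesis using M by simp
    qed
    ultimately show "?g m = 1 - q ^ m" if "m \<in> {M * Suc n - 1, M * Suc n, M * Suc n + 1}" for m
      using that M by (auto simp del: mult_Suc_right)
  qed (use M in auto)
  also have "\<dots> = (1 - q ^ (M * Suc n - 1)) * (1 - q ^ (M * Suc n)) * (1 - q ^ (M * Suc n + 1))"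
  proof -
    have "(\<Prod>m\<in>{a - 1, a, a + 1}. 1 - q ^ m) = (1 - q ^ (a - 1)) * (1 - q ^ a) * (1 - q ^ (a + 1))"
      if "a \<ge> 1" for a
      using that by (cases a) (simp_all add: mult_ac del: power_Suc)
    then show ?thesis using M by simp
  qed
  also have "q ^ (M * Suc n - 1) = q ^ (M - 1) * (q ^ M) ^ n"
    by (simp only: e power_add power_mult)
  also have "q ^ (M * Suc n) = q ^ M * (q ^ M) ^ n"
    by (simp only: mult_Suc_right power_add power_mult)
  also have "q ^ (M * Suc n + 1) = q * (q ^ M) ^ Suc n"
    by (simp only: power_add power_mult power_one_right mult.commute)
  finally show ?case unfolding Suc
    by (simp add: qpoch_Suc[of _ _ n] qpoch_Suc[of _ _ "Suc n"] mult_ac)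
qed

lemma prodinf_residues:
  fixes q :: complex
  assumes q: "norm q < 1" and M: "M \<ge> 3"
  shows "(\<Prod>m. if m \<ge> 1 \<and> m mod M \<notin> {0, 1, M - 1} then 1 / (1 - q ^ m) else 1)
    = qpoch_inf q (q ^ M) * qpoch_inf (q ^ (M - 1)) (q ^ M) * qpoch_inf (q ^ M) (q ^ M) / qpoch_inf q q"
proof (rule LIMSEQ_unique)
  define h where "h = (\<lambda>m. if m \<ge> 1 \<and> m mod M \<notin> {0, 1, M - 1} then 1 / (1 - q ^ m) else 1)"
  \<comment> \<open>The limits below are taken only along the indices M n + 2, so convergence of the
    whole product is needed beforehand. It is obtained from the reciprocal factors, which differ
    from 1 by a summable sequence.\<close>
  define e where "e = (\<lambda>m. 1 - (if m \<ge> 1 \<and> m mod M \<notin> {0, 1, M - 1} then q ^ m else 0))"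
  have "summable (\<lambda>m. norm q ^ m)" using q by (intro summable_geometric) simp
  then have "summable (\<lambda>m. norm (e m - 1))"
    by (rule summable_comparison_test_ev[rotated])
       (auto intro!: always_eventually simp: e_def norm_power)
  then have "convergent_prod e"
    by (intro abs_convergent_prod_imp_convergent_prod summable_imp_abs_convergent_prod)
  then have "convergent_prod (\<lambda>m. inverse (e m))" by (rule convergent_prod_inverse)
  moreover have "(\<lambda>m. inverse (e m)) = h" by (auto simp: e_def h_def fun_eq_iff divide_inverse)
  ultimately have "(\<lambda>n. \<Prod>m<n. h m) \<longlonglongrightarrow> prodinf h"
    using convergent_prod_LIMSEQ[of h] unfolding LIMSEQ_lessThan_iff_atMost by simp
  moreover have "strict_mono (\<lambda>n. M * n + 2)" using M by (simp add: strict_mono_def)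
  ultimately show "(\<lambda>n. \<Prod>m<M * n + 2. h m)
      \<longlonglongrightarrow> (\<Prod>m. if m \<ge> 1 \<and> m mod M \<notin> {0, 1, M - 1} then 1 / (1 - q ^ m) else 1)"
    unfolding h_def[symmetric] by (rule filterlim_compose[OF _ filterlim_subseq])
  let ?g = "\<lambda>m. if m \<ge> 1 \<and> m mod M \<in> {0, 1, M - 1} then 1 - q ^ m else 1"
  have "h m = ?g m * (if m \<ge> 1 then 1 / (1 - q ^ m) else 1)" for m
    using power_neq_one[OF q, of m] by (auto simp: h_def)
  then have "(\<Prod>m<N. h m) = (\<Prod>m<N. ?g m) * (\<Prod>m<N. if m \<ge> 1 then 1 / (1 - q ^ m) else 1)" for N
    by (simp only: prod.distrib)
  moreover have "(\<Prod>m<Suc N. if m \<ge> 1 then 1 / (1 - q ^ m) else 1) = 1 / qpoch q q N" for N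
    unfolding prod.lessThan_Suc_shift by (simp add: qpoch_def prod_dividef)
  then have "(\<Prod>m<M * n + 2. if m \<ge> 1 then 1 / (1 - q ^ m) else 1) = 1 / qpoch q q (M * n + 1)" for n
    by (simp only: add_2_eq_Suc' add_Suc_right Suc_eq_plus1[symmetric])
  ultimately have "(\<Prod>m<M * n + 2. h m)
      = qpoch q (q ^ M) (Suc n) * qpoch (q ^ (M - 1)) (q ^ M) n * qpoch (q ^ M) (q ^ M) n
        * (1 / qpoch q q (M * n + 1))" for n
    by (simp only: residue_prod[OF M])
  moreover have "norm (q ^ M) < 1" using M by (intro norm_power_less_one q) simp
  then have "(\<lambda>n. qpoch q (q ^ M) (Suc n) * qpoch (q ^ (M - 1)) (q ^ M) n * qpoch (q ^ M) (q ^ M) n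
        * (1 / qpoch q q (M * n + 1)))
     \<longlonglongrightarrow> qpoch_inf q (q ^ M) * qpoch_inf (q ^ (M - 1)) (q ^ M) * qpoch_inf (q ^ M) (q ^ M) * (1 / qpoch_inf q q)"
  proof (intro tendsto_intros LIMSEQ_Suc qpoch_tendsto qpoch_inf_q_nonzero q)
    show "(\<lambda>n. qpoch q q (M * n + 1)) \<longlonglongrightarrow> qpoch_inf q q"
      by (rule filterlim_compose[OF qpoch_tendsto[OF q]], rule filterlim_subseq)
         (use M in \<open>simp add: strict_mono_def\<close>)
  qed
  ultimately show "(\<lambda>n. \<Prod>m<M * n + 2. h m) \<longlonglongrightarrow> qpoch_inf q (q ^ M)
    * qpoch_inf (q ^ (M - 1)) (q ^ M) * qpoch_inf (q ^ M) (q ^ M) / qpoch_inf q q"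
    by simp
qed

lemma cong_pm_one_iff:
  fixes m M :: nat
  assumes "M \<ge> 3"
  shows "(\<not> [int m = 0] (mod int M) \<and> \<not> [int m = 1] (mod int M) \<and> \<not> [int m = - 1] (mod int M))
    \<longleftrightarrow> m mod M \<notin> {0, 1, M - 1}"
proof -
  have "int m mod int M = int (m mod M)" by (simp add: zmod_int)
  moreover have "(-1) mod int M = int (M - 1)"
    using assms zmod_minus1[of "int M"] by (simp add: of_nat_diff)
  moreover have "1 mod int M = int 1" using assms by simp
  ultimately show ?thesis unfolding cong_def by (simp add: of_nat_diff)
qed

subsection \<open>Summation over chains\<close>

lemma summable_on_product:
  fixes f :: "'a \<Rightarrow> real" and g :: "'b \<Rightarrow> real"
  assumes "f summable_on A" "g summable_on B"
    and "\<And>x. x \<in> A \<Longrightarrow> f x \<ge> 0" "\<And>y. y \<in> B \<Longrightarrow> g y \<ge> 0"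
  shows "(\<lambda>(x, y). f x * g y) summable_on A \<times> B"
proof (rule summable_on_SigmaI)
  show "((\<lambda>y. case (x, y) of (x, y) \<Rightarrow> f x * g y) has_sum f x * infsum g B) B" for x
    using assms(2) by (auto intro!: has_sum_cmult_right has_sum_infsum)
  show "(\<lambda>x. f x * infsum g B) summable_on A"
    by (intro summable_on_cmult_left assms)
qed (use assms in auto)

lemma has_sum_square:
  fixes f :: "'a \<Rightarrow> complex"
  assumes f: "(f has_sum s) A"
  shows "((\<lambda>(x, y). f x * f y) has_sum s\<^sup>2) (A \<times> A)"
proof (rule has_sum_SigmaI)
  show "((\<lambda>y. case (x, y) of (x, y) \<Rightarrow> f x * f y) has_sum f x * s) A" for x
    using f by (auto intro!: has_sum_cmult_right)
  show "((\<lambda>x. f x * s) has_sum s\<^sup>2) A"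
    unfolding power2_eq_square by (intro has_sum_cmult_left f)
  have "(\<lambda>x. norm (f x)) summable_on A"
    using has_sum_imp_summable[OF f] by (simp only: summable_on_iff_abs_summable_on_complex)
  then have "(\<lambda>(x, y). norm (f x) * norm (f y)) summable_on A \<times> A"
    by (intro summable_on_product) auto
  then show "(\<lambda>(x, y). f x * f y) summable_on A \<times> A"
    by (intro abs_summable_summable[of "\<lambda>(x, y). f x * f y"]) (simp add: case_prod_unfold norm_mult)
qed

text \<open>A finite set of functions lies in a box, over which the sum factors into truncated
  geometric series. The resulting bound does not depend on the size of the box.\<close>

lemma summable_on_power_PiE:
  fixes c :: real
  assumes c: "0 \<le> c" "c < 1" and I: "finite I"
  shows "(\<lambda>n. c ^ (\<Sum>i\<in>I. n i)) summable_on (I \<rightarrow>\<^sub>E UNIV)"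
proof (rule nonneg_bdd_above_summable_on)
  show "bdd_above (sum (\<lambda>n. c ^ (\<Sum>i\<in>I. n i)) ` {F. F \<subseteq> I \<rightarrow>\<^sub>E UNIV \<and> finite F})"
  proof (rule bdd_aboveI2)
    fix F assume F: "F \<in> {F. F \<subseteq> I \<rightarrow>\<^sub>E (UNIV :: nat set) \<and> finite F}"
    \<comment> \<open>Inserting 0 keeps \<open>Max\<close> meaningful when \<open>F\<close> or
      \<open>I\<close> is empty.\<close>
    define N where "N = Max (insert 0 ((\<lambda>(n, i). n i) ` (F \<times> I)))"
    have "n i \<le> N" if "n \<in> F" "i \<in> I" for n i
      unfolding N_def using F I that by (intro Max_ge) force+
    then have sub: "F \<subseteq> I \<rightarrow>\<^sub>E {..N}" using F by (auto simp: PiE_iff subset_iff)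
    have "(\<Sum>n\<in>F. c ^ (\<Sum>i\<in>I. n i)) \<le> (\<Sum>n\<in>I \<rightarrow>\<^sub>E {..N}. c ^ (\<Sum>i\<in>I. n i))"
      by (intro sum_mono2 sub finite_PiE I) (use c in auto)
    also have "\<dots> = (\<Prod>i\<in>I. \<Sum>j\<le>N. c ^ j)"
      unfolding power_sum by (rule prod_sum_PiE[OF I, symmetric]) simp
    also have "\<dots> \<le> (\<Prod>i\<in>I. 1 / (1 - c))"
    proof (intro prod_mono conjI sum_nonneg)
      have "(\<Sum>j\<le>N. c ^ j) \<le> (\<Sum>j. c ^ j)"
        using c by (intro sum_le_suminf summable_geometric) auto
      then show "(\<Sum>j\<le>N. c ^ j) \<le> 1 / (1 - c)"
        using c by (simp add: suminf_geometric)
    qed (use c in auto)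
    finally show "(\<Sum>n\<in>F. c ^ (\<Sum>i\<in>I. n i)) \<le> (\<Prod>i\<in>I. 1 / (1 - c))" .
  qed
qed (use c in auto)

lemma summable_on_power_nondec_tuples:
  fixes c :: real
  assumes "0 \<le> c" "c < 1"
  shows "(\<lambda>n. c ^ (\<Sum>i=1..k. n i)) summable_on nondec_tuples k"
  by (rule summable_on_subset[OF summable_on_power_PiE[OF assms]]) (auto simp: nondec_tuples_def)

text \<open>The part of the summand belonging to one chain alone; the factors 1/(q;q)_(n_1) are left
  to the coupling, which the kernels represent.\<close>

definition chain_weight :: "complex \<Rightarrow> nat \<Rightarrow> (nat \<Rightarrow> nat) \<Rightarrow> complex" where
  "chain_weight q k n = q ^ ((\<Sum>i=1..k. (n i)\<^sup>2) + (\<Sum>i=1..k. n i))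
     / (\<Prod>i=1..<k. qpoch q q (n (i + 1) - n i))"

text \<open>On the support of the kernel r <= n_1 <= n_1^2, so \<open>r\<close> can be taken out of
  the quadratic exponent while the linear exponent remains for the sum over tuples. The constant is
  uniform in \<open>r\<close>, as the later exchange of summations requires.\<close>

lemma chain_weight_bound:
  assumes q: "norm q < 1" and k: "k \<ge> 1"
  obtains K where "K > 0" "\<And>n r. norm (chain_weight q k n * bailey_kernel q (n 1) r)
      \<le> K * norm q ^ r * norm q ^ (\<Sum>i=1..k. n i)"
proof -
  obtain C where C: "C > 0" "\<And>n. norm (1 / qpoch q q n) \<le> C" "\<And>n r. norm (bailey_kernel q n r) \<le> C"
    using qpoch_bounds[OF q] by metis
  have "norm (chain_weight q k n * bailey_kernel q (n 1) r)
      \<le> C ^ (k - 1) * C * norm q ^ r * norm q ^ (\<Sum>i=1..k. n i)" for n r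
  proof (cases "r \<le> n 1")
    case True
    have "n 1 \<le> (n 1)\<^sup>2" by (simp add: power2_eq_square)
    also have "\<dots> \<le> (\<Sum>i=1..k. (n i)\<^sup>2)" using k by (intro member_le_sum) auto
    finally have e: "r + (\<Sum>i=1..k. n i) \<le> (\<Sum>i=1..k. (n i)\<^sup>2) + (\<Sum>i=1..k. n i)"
      using True by simp
    have "chain_weight q k n * bailey_kernel q (n 1) r
        = q ^ ((\<Sum>i=1..k. (n i)\<^sup>2) + (\<Sum>i=1..k. n i))
          * (\<Prod>i=1..<k. 1 / qpoch q q (n (i + 1) - n i)) * bailey_kernel q (n 1) r"
      by (simp add: chain_weight_def prod_dividef)
    then have "norm (chain_weight q k n * bailey_kernel q (n 1) r)
        = norm (q ^ ((\<Sum>i=1..k. (n i)\<^sup>2) + (\<Sum>i=1..k. n i)))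
          * (\<Prod>i=1..<k. norm (1 / qpoch q q (n (i + 1) - n i))) * norm (bailey_kernel q (n 1) r)"
      by (simp only: norm_mult prod_norm)
    also have "\<dots> \<le> norm q ^ (r + (\<Sum>i=1..k. n i)) * (\<Prod>i=1..<k. C) * C"
      by (intro mult_mono norm_power_le_power q e prod_mono C conjI norm_ge_zero)
         (use C(1) in \<open>auto intro!: mult_nonneg_nonneg prod_nonneg\<close>)
    finally show ?thesis by (simp add: power_add mult_ac)
  next
    case False
    then show ?thesis using C(1) by (simp add: bailey_kernel_eq_0)
  qed
  then show ?thesis using C(1) by (intro that[of "C ^ (k - 1) * C"]) auto
qed

lemma chain_weight_summable:
  assumes q: "norm q < 1" and k: "k \<ge> 1"
  shows "(\<lambda>n. chain_weight q k n * bailey_kernel q (n 1) r) summable_on nondec_tuples k"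
proof -
  obtain K where K: "K > 0" "\<And>n r. norm (chain_weight q k n * bailey_kernel q (n 1) r)
      \<le> K * norm q ^ r * norm q ^ (\<Sum>i=1..k. n i)"
    using chain_weight_bound[OF assms] by blast
  have s: "(\<lambda>n. K * norm q ^ r * norm q ^ (\<Sum>i=1..k. n i)) summable_on nondec_tuples k"
    using q by (intro summable_on_cmult_right summable_on_power_nondec_tuples) auto
  show ?thesis
    by (rule abs_summable_summable, rule Infinite_Sum.abs_summable_on_comparison_test'[OF s K(2)])
qed

lemma nondec_tuples_le: "n \<in> nondec_tuples k \<Longrightarrow> 1 \<le> i \<Longrightarrow> i \<le> j \<Longrightarrow> j \<le> k \<Longrightarrow> n i \<le> n j"
  by (auto simp: nondec_tuples_def mono_on_def)

text \<open>Chains grow at the small end, because the kernel sees only the first entry and the new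
  entry ranges over the finite set of values up to the old first one. The restriction keeps the
  tuple extensional.\<close>

definition prepend :: "nat \<Rightarrow> (nat \<Rightarrow> nat) \<times> nat \<Rightarrow> nat \<Rightarrow> nat" where
  "prepend k = (\<lambda>(n, m). \<lambda>i\<in>{1..Suc k}. if i = 1 then m else n (i - 1))"

lemma bij_betw_prepend:
  assumes k: "k \<ge> 1"
  shows "bij_betw (prepend k) (SIGMA n:nondec_tuples k. {..n 1}) (nondec_tuples (Suc k))"
proof (rule bij_betw_byWitness[where f' = "\<lambda>n. (\<lambda>i\<in>{1..k}. n (Suc i), n 1)"])
  show "\<forall>p\<in>SIGMA n:nondec_tuples k. {..n 1}. (\<lambda>i\<in>{1..k}. prepend k p (Suc i), prepend k p 1) = p"
    by (auto simp: prepend_def nondec_tuples_def fun_eq_iff restrict_def PiE_def extensional_def)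
  show "\<forall>n\<in>nondec_tuples (Suc k). prepend k (\<lambda>i\<in>{1..k}. n (Suc i), n 1) = n"
    by (auto simp: prepend_def nondec_tuples_def fun_eq_iff restrict_def PiE_def extensional_def)
  show "prepend k ` (SIGMA n:nondec_tuples k. {..n 1}) \<subseteq> nondec_tuples (Suc k)"
  proof clarify
    fix n m assume n: "n \<in> nondec_tuples k" and m: "m \<le> n 1"
    have "mono_on {1..Suc k} (prepend k (n, m))"
    proof (rule mono_onI)
      fix i j assume ij: "i \<in> {1..Suc k}" "j \<in> {1..Suc k}" "i \<le> j"
      show "prepend k (n, m) i \<le> prepend k (n, m) j"
      proof (cases "i = 1 \<and> j \<noteq> 1")
        case True
        have "m \<le> n 1" by fact
        also have "n 1 \<le> n (j - 1)" using True ij by (intro nondec_tuples_le[OF n]) auto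
        finally show ?thesis using True ij by (simp add: prepend_def)
      next
        case False
        have "n (i - 1) \<le> n (j - 1)" if "i \<noteq> 1"
          using that ij by (intro nondec_tuples_le[OF n]) auto
        then show ?thesis using False ij by (auto simp: prepend_def)
      qed
    qed
    then show "prepend k (n, m) \<in> nondec_tuples (Suc k)"
      by (simp add: nondec_tuples_def prepend_def)
  qed
  show "(\<lambda>n. (\<lambda>i\<in>{1..k}. n (Suc i), n 1)) ` nondec_tuples (Suc k) \<subseteq> (SIGMA n:nondec_tuples k. {..n 1})"
  proof (rule image_subsetI)
    fix n assume n: "n \<in> nondec_tuples (Suc k)"
    have "mono_on {1..k} (\<lambda>i\<in>{1..k}. n (Suc i))"
      by (rule mono_onI) (simp add: nondec_tuples_le[OF n])
    moreover have "n 1 \<le> n (Suc 1)" using k by (intro nondec_tuples_le[OF n]) auto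
    ultimately show "(\<lambda>i\<in>{1..k}. n (Suc i), n 1) \<in> (SIGMA n:nondec_tuples k. {..n 1})"
      using k by (simp add: nondec_tuples_def)
  qed
qed

lemma chain_weight_prepend:
  assumes k: "k \<ge> 1"
  shows "chain_weight q (Suc k) (prepend k (n, m))
    = chain_weight q k n * (q ^ (m\<^sup>2 + m) / qpoch q q (n 1 - m))"
proof -
  have s: "(\<Sum>i=1..Suc k. f (prepend k (n, m) i)) = f m + (\<Sum>i=1..k. f (n i))" for f :: "nat \<Rightarrow> nat"
  proof -
    have "(\<Sum>i=1..Suc k. f (prepend k (n, m) i))
        = f (prepend k (n, m) 1) + (\<Sum>i=Suc 1..Suc k. f (prepend k (n, m) i))"
      by (intro sum.atLeast_Suc_atMost) simp
    also have "(\<Sum>i=Suc 1..Suc k. f (prepend k (n, m) i)) = (\<Sum>i=1..k. f (prepend k (n, m) (Suc i)))"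
      by (rule sum.shift_bounds_cl_Suc_ivl)
    also have "\<dots> = (\<Sum>i=1..k. f (n i))"
      by (intro sum.cong) (auto simp: prepend_def)
    finally show ?thesis by (simp add: prepend_def)
  qed
  have "(\<Prod>i=1..<Suc k. qpoch q q (prepend k (n, m) (i + 1) - prepend k (n, m) i))
      = qpoch q q (prepend k (n, m) (1 + 1) - prepend k (n, m) 1)
        * (\<Prod>i=Suc 1..<Suc k. qpoch q q (prepend k (n, m) (i + 1) - prepend k (n, m) i))"
    using k by (intro prod.atLeast_Suc_lessThan) simp
  also have "(\<Prod>i=Suc 1..<Suc k. qpoch q q (prepend k (n, m) (i + 1) - prepend k (n, m) i))
      = (\<Prod>i=1..<k. qpoch q q (prepend k (n, m) (Suc i + 1) - prepend k (n, m) (Suc i)))"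
    by (rule prod.shift_bounds_Suc_ivl)
  also have "\<dots> = (\<Prod>i=1..<k. qpoch q q (n (i + 1) - n i))"
    by (intro prod.cong) (auto simp: prepend_def)
  also have "prepend k (n, m) (1 + 1) = n 1" using k by (simp add: prepend_def)
  also have "prepend k (n, m) 1 = m" by (simp add: prepend_def)
  finally have p: "(\<Prod>i=1..<Suc k. qpoch q q (prepend k (n, m) (i + 1) - prepend k (n, m) i))
      = qpoch q q (n 1 - m) * (\<Prod>i=1..<k. qpoch q q (n (i + 1) - n i))" .
  show ?thesis
    unfolding chain_weight_def p s[of "\<lambda>j. j\<^sup>2"] s[of "\<lambda>j. j"]
    by (simp add: power_add mult_ac)
qed

text \<open>Summing out the smallest entry is a finite sum, to which the finite Bailey lemma
  applies: the chain loses one entry and gains the eigenvalue q^(r^2+r). Only the last remaining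
  entry has an infinite range, and it contributes 1/(q^2;q)_inf.\<close>

lemma chain_weight_has_sum:
  assumes q: "norm q < 1" and k: "k \<ge> 1"
  shows "((\<lambda>n. chain_weight q k n * bailey_kernel q (n 1) r)
     has_sum (q ^ (k * (r\<^sup>2 + r)) / qpoch_inf (q\<^sup>2) q)) (nondec_tuples k)"
  using k
proof (induction k rule: nat_induct_at_least)
  case base
  have "bij_betw (\<lambda>n::nat. \<lambda>i\<in>{1::nat..1}. n) UNIV (nondec_tuples 1)"
    by (rule bij_betw_byWitness[where f' = "\<lambda>n. n 1"])
       (auto simp: nondec_tuples_def mono_on_def fun_eq_iff restrict_def PiE_def extensional_def)
  note bij = has_sum_reindex_bij_betw[OF this, of "\<lambda>n. chain_weight q 1 n * bailey_kernel q (n 1) r"]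
  have eq: "chain_weight q 1 (\<lambda>i\<in>{1..1}. n) * bailey_kernel q ((\<lambda>i\<in>{1::nat..1}. n) 1) r
      = q ^ (n\<^sup>2 + n) * bailey_kernel q n r" for n
    by (simp add: chain_weight_def)
  have "(\<lambda>n. q ^ (n\<^sup>2 + n) * bailey_kernel q n r) summable_on UNIV"
    using chain_weight_summable[OF q, of 1 r] bij unfolding eq summable_on_def by auto
  then obtain s where "((\<lambda>n. q ^ (n\<^sup>2 + n) * bailey_kernel q n r) has_sum s) UNIV"
    by (auto simp: summable_on_def)
  moreover from has_sum_imp_sums[OF this] have "s = q ^ (r\<^sup>2 + r) / qpoch_inf (q\<^sup>2) q"
    using bailey_lemma_kernel_sums[OF q, of r] by (rule sums_unique2)
  ultimately show ?case using bij unfolding eq by simp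
next
  case (Suc k)
  let ?f = "\<lambda>n. chain_weight q (Suc k) n * bailey_kernel q (n 1) r"
  note bij = has_sum_reindex_bij_betw[OF bij_betw_prepend[OF Suc.hyps], of ?f]
  have eq: "?f (prepend k (n, m)) = chain_weight q k n * (q ^ (m\<^sup>2 + m) / qpoch q q (n 1 - m) * bailey_kernel q m r)"
    for n m
    unfolding chain_weight_prepend[OF Suc.hyps] by (simp add: prepend_def)
  have "((\<lambda>p. ?f (prepend k p)) has_sum (q ^ (Suc k * (r\<^sup>2 + r)) / qpoch_inf (q\<^sup>2) q))
      (SIGMA n:nondec_tuples k. {..n 1})"
  proof (rule has_sum_SigmaI)
    fix n
    have "(\<Sum>m\<le>n 1. ?f (prepend k (n, m))) = q ^ (r\<^sup>2 + r) * (chain_weight q k n * bailey_kernel q (n 1) r)"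
      unfolding eq sum_distrib_left[symmetric] bailey_lemma_kernel[OF q] by simp
    then show "((\<lambda>m. ?f (prepend k (n, m))) has_sum
        q ^ (r\<^sup>2 + r) * (chain_weight q k n * bailey_kernel q (n 1) r)) {..n 1}"
      by (intro has_sum_finiteI) auto
  next
    show "((\<lambda>n. q ^ (r\<^sup>2 + r) * (chain_weight q k n * bailey_kernel q (n 1) r)) has_sum
        q ^ (Suc k * (r\<^sup>2 + r)) / qpoch_inf (q\<^sup>2) q) (nondec_tuples k)"
      using has_sum_cmult_right[OF Suc.IH, of "q ^ (r\<^sup>2 + r)"] by (simp add: power_add)
  next
    show "(\<lambda>p. ?f (prepend k p)) summable_on (SIGMA n:nondec_tuples k. {..n 1})"
      using chain_weight_summable[OF q, of "Suc k" r] bij unfolding summable_on_def by auto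
  qed
  then show ?case using bij by simp
qed

section \<open>The theta series in r and the exchange of summations\<close>

text \<open>This is \<open>theta_sums\<close> at x = q and y = q^(4k): twice
  \<open>Suc r choose 2\<close> is r^2 + r, so y carries the contribution of both chains, and the
  base xy = q^(4k+1) is the source of the modulus.\<close>

lemma bailey_alpha_theta_sums:
  fixes q :: complex and k :: nat
  assumes q: "norm q < 1" and k: "k \<ge> 1"
  defines "M \<equiv> 4 * k + 1"
  shows "(\<lambda>r. bailey_alpha q r * q ^ (2 * k * (r\<^sup>2 + r)))
     sums (qpoch_inf q (q ^ M) * qpoch_inf (q ^ (M - 1)) (q ^ M) * qpoch_inf (q ^ M) (q ^ M) / (1 - q))"
proof -
  have "norm (q ^ (M - 1)) < 1" using k by (intro norm_power_less_one q) (simp add: M_def)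
  moreover have "q * q ^ (M - 1) = q ^ M" by (simp add: M_def)
  ultimately have "(\<lambda>r. (-1) ^ r * q ^ (r choose 2) * (q ^ (M - 1)) ^ (Suc r choose 2) * (1 - q ^ (2 * r + 1)) / (1 - q))
     sums (qpoch_inf q (q ^ M) * qpoch_inf (q ^ (M - 1)) (q ^ M) * qpoch_inf (q ^ M) (q ^ M) / (1 - q))"
    using theta_sums[OF q, of "q ^ (M - 1)"] by (intro sums_divide) simp
  moreover have "(q ^ (M - 1)) ^ (Suc r choose 2) = q ^ (2 * k * (r\<^sup>2 + r))" for r
  proof -
    have "2 * (Suc r choose 2) = r\<^sup>2 + r"
      by (induction r) (simp_all add: Suc_choose_2[of "Suc _"] power2_eq_square binomial_eq_0 algebra_simps)
    then have "(M - 1) * (Suc r choose 2) = 2 * k * (r\<^sup>2 + r)"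
      unfolding M_def by simp
    then show ?thesis by (simp flip: power_mult)
  qed
  ultimately show ?thesis by (simp add: bailey_alpha_def mult_ac)
qed

theorem mainTheorem18:
  fixes k :: nat and q :: complex
  assumes "k \<ge> 1" and "norm q < 1"
  shows "((\<lambda>(n, l).
      q ^ ((\<Sum>i=1..k. (n i)\<^sup>2) + (\<Sum>i=1..k. (l i)\<^sup>2)
            + (\<Sum>i=1..k. n i) + (\<Sum>i=1..k. l i) + n 1 * l 1)
        / ((\<Prod>i=1..<k. qpoch q q (n (i + 1) - n i))
            * (\<Prod>i=1..<k. qpoch q q (l (i + 1) - l i)))
        * (1 / (qpoch (q\<^sup>2) q (n 1 + l 1) * qpoch q q (n 1) * qpoch q q (l 1))))
    has_sum
      (1 / qpoch_inf (q\<^sup>2) q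
        * (\<Prod>m. if m \<ge> 1 \<and> \<not> [int m = 0] (mod (4 * int k + 1))
                   \<and> \<not> [int m = 1] (mod (4 * int k + 1))
                   \<and> \<not> [int m = - 1] (mod (4 * int k + 1))
                then 1 / (1 - q ^ m) else 1)))
    (nondec_tuples k \<times> nondec_tuples k)"
    (is "(?term has_sum ?rhs) ?TT")
proof -
  note k = assms(1) and q = assms(2)
  define T where "T = nondec_tuples k"
  define h where "h = (\<lambda>r n. chain_weight q k n * bailey_kernel q (n 1) r)"
  \<comment> \<open>Summed over \<open>r\<close> first, \<open>g\<close> gives the coupled term of
    the theorem; summed over both chains first, it gives a square.\<close>
  define g where "g = (\<lambda>r (n, l). bailey_alpha q r * (h r n * h r l))"
  define v where "v = (\<lambda>r. q ^ (k * (r\<^sup>2 + r)) / qpoch_inf (q\<^sup>2) q)"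
  have q1: "1 - q \<noteq> 0" using power_neq_one[OF q, of 1] by simp

  obtain K where K: "K > 0" "\<And>n r. norm (h r n) \<le> K * norm q ^ r * norm q ^ (\<Sum>i=1..k. n i)"
    using chain_weight_bound[OF q k] unfolding h_def by blast
  have alpha: "norm (bailey_alpha q r) \<le> 2 / norm (1 - q)" for r
  proof -
    have "norm (1 - q ^ (2 * r + 1)) \<le> norm (1::complex) + norm (q ^ (2 * r + 1))"
      by (rule norm_triangle_ineq4)
    also have "\<dots> \<le> 2" using norm_power_le_power[OF q, of 0 "2 * r + 1"] by simp
    finally have "norm (q ^ (r choose 2)) * norm (1 - q ^ (2 * r + 1)) \<le> 1 * 2"
      using norm_power_le_power[OF q, of 0 "r choose 2"] by (intro mult_mono) auto
    moreover have "norm (bailey_alpha q r) = norm (q ^ (r choose 2)) * norm (1 - q ^ (2 * r + 1)) / norm (1 - q)"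
      unfolding bailey_alpha_def norm_mult norm_divide by (simp add: norm_power)
    ultimately show ?thesis by (simp add: divide_right_mono)
  qed
  \<comment> \<open>One factor bounds alpha, and each chain contributes a \<open>K\<close>. The
    chains also contribute \<open>norm q ^ (2 * r)\<close>, of which a single power
    \<open>norm q ^ r\<close> is enough.\<close>
  define A where "A = 2 / norm (1 - q) * (K * K)"
  define \<rho> where "\<rho> = (\<lambda>n. norm q ^ (\<Sum>i=1..k. n i))"
  have rho: "\<rho> summable_on T"
    unfolding \<rho>_def T_def using q by (intro summable_on_power_nondec_tuples) auto
  have "(\<lambda>r. A * norm q ^ r) summable_on UNIV"
    using q by (intro summable_on_cmult_right summable_on_UNIV_nonneg_real_iff[THEN iffD2] summable_geometric) auto
  moreover have "(\<lambda>(n, l). \<rho> n * \<rho> l) summable_on T \<times> T"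
    by (intro summable_on_product rho) (simp_all add: \<rho>_def)
  ultimately have dom: "(\<lambda>(r, p). A * norm q ^ r * (case p of (n, l) \<Rightarrow> \<rho> n * \<rho> l)) summable_on UNIV \<times> (T \<times> T)"
    by (rule summable_on_product) (use K in \<open>auto simp: A_def \<rho>_def\<close>)
  have "norm (g r (n, l)) \<le> A * norm q ^ r * (\<rho> n * \<rho> l)" for r n l
  proof -
    have "norm (g r (n, l)) = norm (bailey_alpha q r) * (norm (h r n) * norm (h r l))"
      by (simp add: g_def norm_mult)
    also have "\<dots> \<le> 2 / norm (1 - q) * ((K * norm q ^ r * \<rho> n) * (K * norm q ^ r * \<rho> l))"
    proof (rule mult_mono[OF alpha])
      have "norm (h r n) \<le> K * norm q ^ r * \<rho> n" for n
        unfolding \<rho>_def by (rule K(2))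
      moreover have "0 \<le> K * norm q ^ r * \<rho> n" for n
        using K(1) by (simp add: \<rho>_def)
      ultimately show "norm (h r n) * norm (h r l) \<le> (K * norm q ^ r * \<rho> n) * (K * norm q ^ r * \<rho> l)"
        by (intro mult_mono) simp_all
    qed simp_all
    also have "\<dots> = A * norm q ^ (2 * r) * (\<rho> n * \<rho> l)"
      unfolding A_def mult_2 power_add by (simp only: mult_ac)
    also have "\<dots> \<le> A * norm q ^ r * (\<rho> n * \<rho> l)"
      using q K(1) by (intro mult_right_mono mult_left_mono power_decreasing) (auto simp: A_def \<rho>_def)
    finally show ?thesis .
  qed
  then have "(\<lambda>(r, p). g r p) summable_on UNIV \<times> (T \<times> T)"
    by (intro abs_summable_summable[of "\<lambda>(r, p). g r p"]
          Infinite_Sum.abs_summable_on_comparison_test'[OF dom]) auto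
  then obtain I where I: "((\<lambda>(r, p). g r p) has_sum I) (UNIV \<times> (T \<times> T))"
    by (auto simp: summable_on_def)

  have inner: "(g r has_sum bailey_alpha q r * (v r)\<^sup>2) (T \<times> T)" for r
  proof -
    have "(h r has_sum v r) T"
      unfolding h_def v_def T_def by (rule chain_weight_has_sum[OF q k])
    from has_sum_cmult_right[OF has_sum_square[OF this], of "bailey_alpha q r"]
    show ?thesis by (simp add: g_def case_prod_unfold)
  qed
  have "((\<lambda>r. bailey_alpha q r * (v r)\<^sup>2) has_sum I) UNIV"
    by (rule has_sum_SigmaD[OF I]) (use inner in simp)
  then have "(\<lambda>r. bailey_alpha q r * (v r)\<^sup>2) sums I"
    by (rule has_sum_imp_sums)
  moreover have "bailey_alpha q r * (v r)\<^sup>2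
      = bailey_alpha q r * q ^ (2 * k * (r\<^sup>2 + r)) / (qpoch_inf (q\<^sup>2) q)\<^sup>2" for r
    by (simp add: v_def power_divide mult_ac flip: power_mult)
  ultimately have "I = qpoch_inf q (q ^ (4 * k + 1)) * qpoch_inf (q ^ (4 * k)) (q ^ (4 * k + 1))
      * qpoch_inf (q ^ (4 * k + 1)) (q ^ (4 * k + 1)) / (1 - q) / (qpoch_inf (q\<^sup>2) q)\<^sup>2"
    using sums_unique2 sums_divide[OF bailey_alpha_theta_sums[OF q k], of "(qpoch_inf (q\<^sup>2) q)\<^sup>2"]
    by simp
  \<comment> \<open>The \<open>1 - q\<close> from alpha joins one of the two copies of (q^2;q)_inf
    to form (q;q)_inf; the other copy remains as the prefactor.\<close>
  also have "\<dots> = 1 / qpoch_inf (q\<^sup>2) q * (qpoch_inf q (q ^ (4 * k + 1)) * qpoch_inf (q ^ (4 * k)) (q ^ (4 * k + 1))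
      * qpoch_inf (q ^ (4 * k + 1)) (q ^ (4 * k + 1)) / qpoch_inf q q)"
    by (simp add: qpoch_inf_q_eq_q2[OF q] power2_eq_square mult_ac)
  also have "\<dots> = ?rhs"
  proof -
    have M: "4 * k + 1 \<ge> 3" using k by simp
    have e: "4 * int k + 1 = int (4 * k + 1)" by simp
    show ?thesis
      unfolding e cong_pm_one_iff[OF M] prodinf_residues[OF q M] by simp
  qed
  finally have I_eq: "I = ?rhs" .

  \<comment> \<open>For fixed chains the sum over \<open>r\<close> is finite, since the kernel
    vanishes for r > n_1, and \<open>bailey_pair_product\<close> restores the coupling
    factor.\<close>
  have "(?term has_sum I) (T \<times> T)"
  proof (rule has_sum_SigmaD)
    show "((\<lambda>(p, r). g r p) has_sum I) ((T \<times> T) \<times> UNIV)"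
      using I by (subst has_sum_swap) simp
    fix p assume "p \<in> T \<times> T"
    obtain n l where p: "p = (n, l)" by fastforce
    have "(\<Sum>r\<le>n 1. g r p) = chain_weight q k n * chain_weight q k l
        * (\<Sum>r\<le>n 1. bailey_alpha q r * bailey_kernel q (n 1) r * bailey_kernel q (l 1) r)"
      by (simp add: p g_def h_def sum_distrib_left mult_ac)
    also have "\<dots> = ?term p"
      unfolding bailey_pair_product[OF q] by (simp add: p chain_weight_def power_add mult_ac)
    finally show "((\<lambda>r. (case (p, r) of (p, r) \<Rightarrow> g r p)) has_sum ?term p) UNIV"
      by (intro has_sum_finite_neutralI[of "{..n 1}"])
         (auto simp: p g_def h_def bailey_kernel_eq_0)
  qed
  then show ?thesis unfolding I_eq T_def .
qed

end
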